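(* Let $R$ be a finite truncated discrete valuation ring. Let $\theta\colon M\to\operatorname{Hom}(V,W)$ be a module representation over $R$, where each of $M$, $V$, and $W$ is finite. Then: (i) $\operatorname{ask}(\theta^{\circ}) = \frac{|M|}{|V|}\operatorname{ask}(\theta)$. (ii) $\operatorname{ask}(\theta^{\vee}) = \frac{|W|}{|V|}\operatorname{ask}(\theta)$. (iii) $\operatorname{ask}(\theta^{\bullet}) = \operatorname{ask}(\theta)$.
   Context: Rings are associative, commutative, and unital. Maps act on the right, so $x\phi$ is the image of $x$ under $\phi$. A truncated discrete valuation ring is a ring isomorphic to $\mathfrak O/\mathfrak P^n$ for some discrete valuation ring $\mathfrak O$ with maximal ideal $\mathfrak P$ and some $n\ge 0$. A module representation over a ring $R$ is an $R$-module homomorphism $\theta\colon M\to\operatorname{Hom}(V,W)$, where $M,V,W$ are $R$-modules and $\operatorname{Hom}=\operatorname{Hom}_R$. If $M$ and $V$ are finite as sets, then $\operatorname{ask}(\theta)=\frac1{|M|}\sum_{a\in M}|\operatorname{Ker}(a\theta)|$. Write $U^*=\operatorname{Hom}(U,R)$. The following module representations are derived from $\theta$: $\theta^\circ\colon V\to\operatorname{Hom}(M,W)$, $x\mapsto\bigl(a\mapsto x(a\theta)\bigr)$; $\theta^\bullet\colon W^*\to\operatorname{Hom}(V,M^* )$, $\psi\mapsto\bigl(x\mapsto(a\mapsto (x(a\theta))\psi)\bigr)$; $\theta^\vee\colon M\to\operatorname{Hom}(W^*,V^* )$, $a\mapsto (a\theta)^*=\bigl(\psi\mapsto(x\mapsto(x(a\theta))\psi)\bigr)$.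 *)

theory Defs
  imports Complex_Main "HOL-Algebra.Ring_Divisibility" "HOL-Algebra.Ideal_Product" "HOL-Algebra.Module"
begin

section \<open>Truncated discrete valuation rings\<close>

text \<open>A discrete valuation ring is a principal ideal domain with exactly one maximal ideal
  \<open>P\<close>, which is nonzero.\<close>

locale discrete_valuation_ring = principal_domain R for R (structure) +
  fixes P
  assumes maximal: "maximalideal P R"
    and maximal_unique: "maximalideal I R \<Longrightarrow> I = P"
    and maximal_nonzero: "P \<noteq> {\<zero>}"

text \<open>HOL cannot quantify existentially over the type of the elements of \<open>D\<close>. That type is
  therefore a parameter; as an assumption of a theorem with \<open>'d\<close> a type variable, the predicate
  allows every discrete valuation ring. The power is taken in the monoid of ideals of \<open>D\<close>, whose
  unit is \<open>carrier D\<close>; hence \<open>n = 0\<close> gives the zero ring.\<close>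

definition truncated_dvr :: "'d itself \<Rightarrow> ('r, 'k) ring_scheme \<Rightarrow> bool" where
  "truncated_dvr _ R \<longleftrightarrow> cring R \<and>
     (\<exists>(D :: 'd ring) P (n :: nat).
        discrete_valuation_ring D P \<and> R \<simeq> D Quot (P [^]\<^bsub>ideals_set D\<^esub> n))"


section \<open>Modules of homomorphisms\<close>

text \<open>Homomorphisms are extensional (equal to \<open>undefined\<close> outside the carrier), so that each
  homomorphism is represented by exactly one function and cardinalities are correct.
  The fields \<open>mult\<close> and \<open>one\<close>, which module records inherit from ring records,
  play no role in \<open>module R M\<close>.\<close>

definition Hom_module ::
    "('r, 'k) ring_scheme \<Rightarrow> ('r, 'a, 'i) module_scheme \<Rightarrow> ('r, 'b, 'j) module_scheme
      \<Rightarrow> ('r, 'a \<Rightarrow> 'b) module" where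
  "Hom_module R U V =
     \<lparr>carrier = {f \<in> carrier U \<rightarrow>\<^sub>E carrier V.
         (\<forall>x\<in>carrier U. \<forall>y\<in>carrier U. f (x \<oplus>\<^bsub>U\<^esub> y) = f x \<oplus>\<^bsub>V\<^esub> f y) \<and>
         (\<forall>r\<in>carrier R. \<forall>x\<in>carrier U. f (r \<odot>\<^bsub>U\<^esub> x) = r \<odot>\<^bsub>V\<^esub> f x)},
      mult = undefined, one = undefined,
      zero = (\<lambda>x\<in>carrier U. \<zero>\<^bsub>V\<^esub>),
      add = (\<lambda>f g. \<lambda>x\<in>carrier U. f x \<oplus>\<^bsub>V\<^esub> g x),
      smult = (\<lambda>r f. \<lambda>x\<in>carrier U. r \<odot>\<^bsub>V\<^esub> f x)\<rparr>"

definition regular_module :: "('r, 'k) ring_scheme \<Rightarrow> ('r, 'r) module" where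
  "regular_module R =
     \<lparr>carrier = carrier R, mult = mult R, one = one R, zero = zero R, add = add R,
      smult = mult R\<rparr>"

definition dual_module ::
    "('r, 'k) ring_scheme \<Rightarrow> ('r, 'a, 'i) module_scheme \<Rightarrow> ('r, 'a \<Rightarrow> 'r) module" where
  "dual_module R U = Hom_module R U (regular_module R)"


section \<open>Module representations\<close>

locale module_representation =
  M: module R M + V: module R V + W: module R W
  for R :: "('r, 'k) ring_scheme"
    and M :: "('r, 'm, 'i) module_scheme"
    and V :: "('r, 'v, 'j) module_scheme"
    and W :: "('r, 'w, 'l) module_scheme" +
  fixes \<theta> :: "'m \<Rightarrow> 'v \<Rightarrow> 'w"
  assumes hom: "\<theta> \<in> carrier (Hom_module R M (Hom_module R V W))"

definition ask ::
    "('r, 'm, 'i) module_scheme \<Rightarrow> ('r, 'v, 'j) module_scheme \<Rightarrow> ('r, 'w, 'l) module_scheme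
      \<Rightarrow> ('m \<Rightarrow> 'v \<Rightarrow> 'w) \<Rightarrow> real" where
  "ask M V W \<theta> =
     1 / real (card (carrier M)) * (\<Sum>a\<in>carrier M. real (card (a_kernel V W (\<theta> a))))"

text \<open>The three derived representations \<open>\<theta>\<^sup>\<circ>\<close>, \<open>\<theta>\<^sup>\<bullet>\<close> and \<open>\<theta>\<^sup>\<or>\<close>; maps are
  written on the left here.\<close>

definition rep_circ ::
    "('r, 'm, 'i) module_scheme \<Rightarrow> ('r, 'v, 'j) module_scheme
      \<Rightarrow> ('m \<Rightarrow> 'v \<Rightarrow> 'w) \<Rightarrow> 'v \<Rightarrow> 'm \<Rightarrow> 'w" where
  "rep_circ M V \<theta> = (\<lambda>x\<in>carrier V. \<lambda>a\<in>carrier M. \<theta> a x)"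

definition rep_bullet ::
    "('r, 'k) ring_scheme \<Rightarrow> ('r, 'm, 'i) module_scheme \<Rightarrow> ('r, 'v, 'j) module_scheme
      \<Rightarrow> ('r, 'w, 'l) module_scheme \<Rightarrow> ('m \<Rightarrow> 'v \<Rightarrow> 'w)
      \<Rightarrow> ('w \<Rightarrow> 'r) \<Rightarrow> 'v \<Rightarrow> 'm \<Rightarrow> 'r" where
  "rep_bullet R M V W \<theta> =
     (\<lambda>\<psi>\<in>carrier (dual_module R W). \<lambda>x\<in>carrier V. \<lambda>a\<in>carrier M. \<psi> (\<theta> a x))"

definition rep_vee ::
    "('r, 'k) ring_scheme \<Rightarrow> ('r, 'm, 'i) module_scheme \<Rightarrow> ('r, 'v, 'j) module_scheme
      \<Rightarrow> ('r, 'w, 'l) module_scheme \<Rightarrow> ('m \<Rightarrow> 'v \<Rightarrow> 'w)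
      \<Rightarrow> 'm \<Rightarrow> ('w \<Rightarrow> 'r) \<Rightarrow> 'v \<Rightarrow> 'r" where
  "rep_vee R M V W \<theta> =
     (\<lambda>a\<in>carrier M. \<lambda>\<psi>\<in>carrier (dual_module R W). \<lambda>x\<in>carrier V. \<psi> (\<theta> a x))"


subsection \<open>The derived maps are module representations\<close>

lemma Hom_moduleD:
  assumes "f \<in> carrier (Hom_module R U V)"
  shows "\<And>x. x \<in> carrier U \<Longrightarrow> f x \<in> carrier V"
    and "\<And>x y. \<lbrakk>x \<in> carrier U; y \<in> carrier U\<rbrakk> \<Longrightarrow> f (x \<oplus>\<^bsub>U\<^esub> y) = f x \<oplus>\<^bsub>V\<^esub> f y"
    and "\<And>r x. \<lbrakk>r \<in> carrier R; x \<in> carrier U\<rbrakk> \<Longrightarrow> f (r \<odot>\<^bsub>U\<^esub> x) = r \<odot>\<^bsub>V\<^esub> f x"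
    and "f \<in> extensional (carrier U)"
  using assms by (auto simp: Hom_module_def PiE_iff)

lemma restrict_mem_Hom_module:
  assumes "module R U"
    and "\<And>x. x \<in> carrier U \<Longrightarrow> f x \<in> carrier V"
    and "\<And>x y. \<lbrakk>x \<in> carrier U; y \<in> carrier U\<rbrakk> \<Longrightarrow> f (x \<oplus>\<^bsub>U\<^esub> y) = f x \<oplus>\<^bsub>V\<^esub> f y"
    and "\<And>r x. \<lbrakk>r \<in> carrier R; x \<in> carrier U\<rbrakk> \<Longrightarrow> f (r \<odot>\<^bsub>U\<^esub> x) = r \<odot>\<^bsub>V\<^esub> f x"
  shows "(\<lambda>x\<in>carrier U. f x) \<in> carrier (Hom_module R U V)"
proof -
  interpret U: module R U by fact
  show ?thesis
    using assms(2-4) by (simp add: Hom_module_def)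
qed

lemma Hom_module_ops:
  "f \<oplus>\<^bsub>Hom_module R U V\<^esub> g = (\<lambda>x\<in>carrier U. f x \<oplus>\<^bsub>V\<^esub> g x)"
  "r \<odot>\<^bsub>Hom_module R U V\<^esub> f = (\<lambda>x\<in>carrier U. r \<odot>\<^bsub>V\<^esub> f x)"
  "\<zero>\<^bsub>Hom_module R U V\<^esub> = (\<lambda>x\<in>carrier U. \<zero>\<^bsub>V\<^esub>)"
  by (simp_all add: Hom_module_def)

lemma module_Hom_module:
  assumes "module R U" "module R V"
  shows "module R (Hom_module R U V)"
proof -
  interpret U: module R U by fact
  interpret V: module R V by fact
  note D = Hom_moduleD[of _ R U V]
  note I = restrict_mem_Hom_module[OF assms(1), of _ V]
  let ?H = "Hom_module R U V"
  have add: "f \<oplus>\<^bsub>?H\<^esub> g \<in> carrier ?H" if "f \<in> carrier ?H" "g \<in> carrier ?H" for f g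
    unfolding Hom_module_ops
    by (rule I) (simp_all add: D[OF that(1)] D[OF that(2)] V.M.a_ac V.smult_r_distr)
  have zero: "\<zero>\<^bsub>?H\<^esub> \<in> carrier ?H"
    unfolding Hom_module_ops by (rule I) simp_all
  have smult: "r \<odot>\<^bsub>?H\<^esub> f \<in> carrier ?H" if "r \<in> carrier R" "f \<in> carrier ?H" for r f
    unfolding Hom_module_ops
    by (rule I)
      (simp_all add: D[OF that(2)] that(1) V.smult_r_distr V.smult_assoc1[symmetric] U.R.m_comm)
  show ?thesis
  proof (rule moduleI)
    show "cring R" by (rule U.R.is_cring)
    show "abelian_group ?H"
    proof (rule abelian_groupI)
      fix f assume f: "f \<in> carrier ?H"
      have "(\<lambda>x\<in>carrier U. \<ominus>\<^bsub>V\<^esub> f x) \<in> carrier ?H"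
        by (rule I) (simp_all add: D[OF f] V.M.minus_add V.smult_r_minus)
      moreover have "(\<lambda>x\<in>carrier U. \<ominus>\<^bsub>V\<^esub> f x) \<oplus>\<^bsub>?H\<^esub> f = \<zero>\<^bsub>?H\<^esub>"
        unfolding Hom_module_ops by (rule restrict_ext) (simp add: D[OF f] V.M.l_neg)
      ultimately show "\<exists>g\<in>carrier ?H. g \<oplus>\<^bsub>?H\<^esub> f = \<zero>\<^bsub>?H\<^esub>" by blast
      show "\<zero>\<^bsub>?H\<^esub> \<oplus>\<^bsub>?H\<^esub> f = f"
        unfolding Hom_module_ops
        by (rule extensionalityI[where A = "carrier U"]) (simp_all add: D[OF f])
    next
      fix f g assume f: "f \<in> carrier ?H" and g: "g \<in> carrier ?H"
      show "f \<oplus>\<^bsub>?H\<^esub> g = g \<oplus>\<^bsub>?H\<^esub> f"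
        unfolding Hom_module_ops by (rule restrict_ext) (simp add: D[OF f] D[OF g] V.M.a_comm)
      fix h assume h: "h \<in> carrier ?H"
      show "f \<oplus>\<^bsub>?H\<^esub> g \<oplus>\<^bsub>?H\<^esub> h = f \<oplus>\<^bsub>?H\<^esub> (g \<oplus>\<^bsub>?H\<^esub> h)"
        unfolding Hom_module_ops
        by (rule restrict_ext) (simp add: D[OF f] D[OF g] D[OF h] V.M.a_assoc)
    qed (fact add zero)+
  next
    fix r s f assume r: "r \<in> carrier R" and s: "s \<in> carrier R" and f: "f \<in> carrier ?H"
    show "(r \<oplus>\<^bsub>R\<^esub> s) \<odot>\<^bsub>?H\<^esub> f = r \<odot>\<^bsub>?H\<^esub> f \<oplus>\<^bsub>?H\<^esub> s \<odot>\<^bsub>?H\<^esub> f"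
      unfolding Hom_module_ops by (rule restrict_ext) (simp add: D[OF f] r s V.smult_l_distr)
    show "(r \<otimes>\<^bsub>R\<^esub> s) \<odot>\<^bsub>?H\<^esub> f = r \<odot>\<^bsub>?H\<^esub> (s \<odot>\<^bsub>?H\<^esub> f)"
      unfolding Hom_module_ops by (rule restrict_ext) (simp add: D[OF f] r s V.smult_assoc1)
  next
    fix r f g assume r: "r \<in> carrier R" and f: "f \<in> carrier ?H" and g: "g \<in> carrier ?H"
    show "r \<odot>\<^bsub>?H\<^esub> (f \<oplus>\<^bsub>?H\<^esub> g) = r \<odot>\<^bsub>?H\<^esub> f \<oplus>\<^bsub>?H\<^esub> r \<odot>\<^bsub>?H\<^esub> g"
      unfolding Hom_module_ops
      by (rule restrict_ext) (simp add: D[OF f] D[OF g] r V.smult_r_distr)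
  next
    fix f assume f: "f \<in> carrier ?H"
    show "\<one>\<^bsub>R\<^esub> \<odot>\<^bsub>?H\<^esub> f = f"
      unfolding Hom_module_ops
      by (rule extensionalityI[where A = "carrier U"]) (simp_all add: D[OF f])
  qed (fact smult)
qed

lemma module_regular_module:
  assumes "cring R"
  shows "module R (regular_module R)"
proof -
  interpret R: cring R by fact
  show ?thesis
  proof (rule moduleI)
    show "abelian_group (regular_module R)"
    proof (rule abelian_groupI)
      fix x assume "x \<in> carrier (regular_module R)"
      then show "\<exists>y\<in>carrier (regular_module R). y \<oplus>\<^bsub>regular_module R\<^esub> x = \<zero>\<^bsub>regular_module R\<^esub>"
        using R.l_neg[of x] by (auto simp: regular_module_def)
    qed (simp_all add: regular_module_def R.a_ac)
  qed (simp_all add: regular_module_def R.m_assoc R.l_distr R.r_distr assms)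
qed

lemma module_dual_module:
  assumes "module R U"
  shows "module R (dual_module R U)"
  unfolding dual_module_def
  by (intro module_Hom_module assms module_regular_module module.axioms(1)[OF assms])

lemma dual_ops:
  "f \<oplus>\<^bsub>dual_module R U\<^esub> g = (\<lambda>x\<in>carrier U. f x \<oplus>\<^bsub>R\<^esub> g x)"
  "r \<odot>\<^bsub>dual_module R U\<^esub> f = (\<lambda>x\<in>carrier U. r \<otimes>\<^bsub>R\<^esub> f x)"
  by (simp_all add: dual_module_def Hom_module_ops regular_module_def)

lemma module_representationI:
  assumes "module R M" "module R V" "module R W"
    and "\<And>a x. \<lbrakk>a \<in> carrier M; x \<in> carrier V\<rbrakk> \<Longrightarrow> f a x \<in> carrier W"
    and "\<And>a b x. \<lbrakk>a \<in> carrier M; b \<in> carrier M; x \<in> carrier V\<rbrakk>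
      \<Longrightarrow> f (a \<oplus>\<^bsub>M\<^esub> b) x = f a x \<oplus>\<^bsub>W\<^esub> f b x"
    and "\<And>r a x. \<lbrakk>r \<in> carrier R; a \<in> carrier M; x \<in> carrier V\<rbrakk>
      \<Longrightarrow> f (r \<odot>\<^bsub>M\<^esub> a) x = r \<odot>\<^bsub>W\<^esub> f a x"
    and "\<And>a x y. \<lbrakk>a \<in> carrier M; x \<in> carrier V; y \<in> carrier V\<rbrakk>
      \<Longrightarrow> f a (x \<oplus>\<^bsub>V\<^esub> y) = f a x \<oplus>\<^bsub>W\<^esub> f a y"
    and "\<And>r a x. \<lbrakk>r \<in> carrier R; a \<in> carrier M; x \<in> carrier V\<rbrakk>
      \<Longrightarrow> f a (r \<odot>\<^bsub>V\<^esub> x) = r \<odot>\<^bsub>W\<^esub> f a x"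
  shows "module_representation R M V W (\<lambda>a\<in>carrier M. \<lambda>x\<in>carrier V. f a x)"
proof -
  interpret M: module R M by fact
  interpret V: module R V by fact
  interpret W: module R W by fact
  show ?thesis
  proof unfold_locales
    show "(\<lambda>a\<in>carrier M. \<lambda>x\<in>carrier V. f a x) \<in> carrier (Hom_module R M (Hom_module R V W))"
    proof (rule restrict_mem_Hom_module)
      show "(\<lambda>x\<in>carrier V. f a x) \<in> carrier (Hom_module R V W)" if "a \<in> carrier M" for a
        by (rule restrict_mem_Hom_module) (simp_all add: assms that)
    qed (auto simp: assms Hom_module_ops intro!: restrict_ext)
  qed
qed

context module_representation
begin

lemma rep_closed: "\<lbrakk>a \<in> carrier M; x \<in> carrier V\<rbrakk> \<Longrightarrow> \<theta> a x \<in> carrier W"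
  by (rule Hom_moduleD(1)[OF Hom_moduleD(1)[OF hom]])

lemma rep_linear_left:
  assumes "x \<in> carrier V"
  shows "\<lbrakk>a \<in> carrier M; b \<in> carrier M\<rbrakk> \<Longrightarrow> \<theta> (a \<oplus>\<^bsub>M\<^esub> b) x = \<theta> a x \<oplus>\<^bsub>W\<^esub> \<theta> b x"
    and "\<lbrakk>r \<in> carrier R; a \<in> carrier M\<rbrakk> \<Longrightarrow> \<theta> (r \<odot>\<^bsub>M\<^esub> a) x = r \<odot>\<^bsub>W\<^esub> \<theta> a x"
  using assms by (simp_all add: Hom_moduleD(2,3)[OF hom] Hom_module_ops)

lemma rep_linear_right:
  assumes "a \<in> carrier M"
  shows "\<lbrakk>x \<in> carrier V; y \<in> carrier V\<rbrakk> \<Longrightarrow> \<theta> a (x \<oplus>\<^bsub>V\<^esub> y) = \<theta> a x \<oplus>\<^bsub>W\<^esub> \<theta> a y"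
    and "\<lbrakk>r \<in> carrier R; x \<in> carrier V\<rbrakk> \<Longrightarrow> \<theta> a (r \<odot>\<^bsub>V\<^esub> x) = r \<odot>\<^bsub>W\<^esub> \<theta> a x"
  using Hom_moduleD(2,3)[OF Hom_moduleD(1)[OF hom assms]] by auto

lemma dualD:
  assumes "\<psi> \<in> carrier (dual_module R W)"
  shows "\<And>w. w \<in> carrier W \<Longrightarrow> \<psi> w \<in> carrier R"
    and "\<And>w z. \<lbrakk>w \<in> carrier W; z \<in> carrier W\<rbrakk> \<Longrightarrow> \<psi> (w \<oplus>\<^bsub>W\<^esub> z) = \<psi> w \<oplus>\<^bsub>R\<^esub> \<psi> z"
    and "\<And>r w. \<lbrakk>r \<in> carrier R; w \<in> carrier W\<rbrakk> \<Longrightarrow> \<psi> (r \<odot>\<^bsub>W\<^esub> w) = r \<otimes>\<^bsub>R\<^esub> \<psi> w"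
  using Hom_moduleD[OF assms[unfolded dual_module_def]] by (simp_all add: regular_module_def)

lemma module_representation_circ: "module_representation R V M W (rep_circ M V \<theta>)"
  unfolding rep_circ_def
  by (rule module_representationI)
    (simp_all add: rep_closed rep_linear_left rep_linear_right
      M.module_axioms V.module_axioms W.module_axioms)

lemma module_representation_bullet:
  "module_representation R (dual_module R W) V (dual_module R M) (rep_bullet R M V W \<theta>)"
  unfolding rep_bullet_def
proof (rule module_representationI)
  fix \<psi> x assume \<psi>: "\<psi> \<in> carrier (dual_module R W)" and x: "x \<in> carrier V"
  show "(\<lambda>a\<in>carrier M. \<psi> (\<theta> a x)) \<in> carrier (dual_module R M)"
    unfolding dual_module_def
    by (rule restrict_mem_Hom_module)
      (simp_all add: regular_module_def dualD[OF \<psi>] x rep_closed rep_linear_left M.module_axioms)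
qed (auto simp: module_dual_module M.module_axioms V.module_axioms W.module_axioms
  dualD rep_closed rep_linear_right dual_ops intro!: restrict_ext)

lemma module_representation_vee:
  "module_representation R M (dual_module R W) (dual_module R V) (rep_vee R M V W \<theta>)"
  unfolding rep_vee_def
proof (rule module_representationI)
  fix a \<psi> assume a: "a \<in> carrier M" and \<psi>: "\<psi> \<in> carrier (dual_module R W)"
  show "(\<lambda>x\<in>carrier V. \<psi> (\<theta> a x)) \<in> carrier (dual_module R V)"
    unfolding dual_module_def
    by (rule restrict_mem_Hom_module)
      (simp_all add: regular_module_def dualD[OF \<psi>] a rep_closed rep_linear_right V.module_axioms)
qed (auto simp: module_dual_module M.module_axioms V.module_axioms W.module_axioms
  dualD rep_closed rep_linear_left dual_ops intro!: restrict_ext)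

end

end

theory Submission
  imports Defs
begin

text \<open>Up to normalisation, \<open>ask \<theta>\<close> counts the pairs \<open>(a, x)\<close> with \<open>\<theta> a x = \<zero>\<close>. This condition does
  not distinguish \<open>M\<close> from \<open>V\<close>, which gives (i) over any ring (\<open>ask_circ\<close>).

  For (ii), the kernel of the transpose of a homomorphism \<open>V \<rightarrow> W\<close> consists of the functionals on
  \<open>W\<close> that vanish on the image. Hence it suffices that a submodule \<open>N\<close> of a finite module \<open>W\<close>
  satisfies \<open>|N\<^sup>\<bottom>| |N| = |W|\<close>, where \<open>N\<^sup>\<bottom>\<close> is the annihilator of \<open>N\<close> in the dual of \<open>W\<close>
  (\<open>card_annihilator\<close>); the sizes of image and kernel are related by \<open>|V| = |ker| |im|\<close>.

  The annihilator formula expresses that \<open>R\<close> is injective as a module over itself, and it is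
  proved by extending functionals step by step. A truncated discrete valuation ring has a nilpotent
  element \<open>\<pi>\<close> such that every element is a unit or a multiple of \<open>\<pi>\<close>
  (\<open>truncated_dvr_imp_nilpotent_uniformiser\<close>). If \<open>N \<noteq> W\<close>, some \<open>w \<notin> N\<close> has \<open>\<pi>w \<in> N\<close>, since \<open>\<pi>\<close> is
  nilpotent. Then \<open>rw \<in> N\<close> exactly for \<open>r \<in> \<pi>R\<close>, so \<open>N + Rw\<close> is larger than \<open>N\<close> by the factor
  \<open>|R| / |\<pi>R|\<close> (\<open>card_adjoin\<close>). A functional \<open>f\<close> on \<open>N\<close> extends to \<open>N + Rw\<close> by choosing as value at
  \<open>w\<close> any solution \<open>d\<close> of \<open>\<pi>d = f(\<pi>w)\<close> (\<open>extension_values\<close>). Solutions exist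
  (\<open>value_is_multiple\<close>) and form a coset of the annihilator of \<open>\<pi>\<close> in \<open>R\<close>, which has
  \<open>|R| / |\<pi>R|\<close> elements. So the number of functionals grows by the same factor as the module, also
  when only functionals vanishing on a fixed \<open>N\<^sub>0\<close> are counted. Going from \<open>N\<^sub>0 = N\<close> up to \<open>W\<close>
  gives the formula.

  Finally, \<open>\<theta>\<^sup>\<bullet>\<close> is obtained from \<open>\<theta>\<close> by applying \<open>\<circ>\<close>, \<open>\<or>\<close> and \<open>\<circ>\<close> in this order. Since \<open>W\<close> and its
  dual have the same size, the factors from (i), (ii) and (i) cancel, which is (iii).\<close>


section \<open>Homomorphisms of finite modules\<close>

lemma card_eq_card_fibre_mult:
  assumes "finite A" "finite B" "f ` A \<subseteq> B"
    and "\<And>b. b \<in> B \<Longrightarrow> card {a \<in> A. f a = b} = k"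
  shows "card A = k * card B"
proof -
  have "card A = (\<Sum>b\<in>B. \<Sum>a | a \<in> A \<and> f a = b. 1)"
    using sum.group[OF assms(1-3), of "\<lambda>_. 1 :: nat"] by simp
  also have "\<dots> = k * card B"
    using assms(4) by simp
  finally show ?thesis .
qed

lemma Hom_module_zero:
  assumes "module R U" "module R V" "f \<in> carrier (Hom_module R U V)"
  shows "f \<zero>\<^bsub>U\<^esub> = \<zero>\<^bsub>V\<^esub>"
proof -
  interpret U: module R U by fact
  interpret V: module R V by fact
  show ?thesis
    using Hom_moduleD(3)[OF assms(3), of "\<zero>\<^bsub>R\<^esub>" "\<zero>\<^bsub>U\<^esub>"] Hom_moduleD(1)[OF assms(3), of "\<zero>\<^bsub>U\<^esub>"] by simp
qed

lemma Hom_module_minus: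
  assumes "module R U" "module R V" "f \<in> carrier (Hom_module R U V)" "x \<in> carrier U"
  shows "f (\<ominus>\<^bsub>U\<^esub> x) = \<ominus>\<^bsub>V\<^esub> f x"
proof -
  interpret U: module R U by fact
  interpret V: module R V by fact
  note D = Hom_moduleD[OF assms(3)]
  have "f (\<ominus>\<^bsub>U\<^esub> x) \<oplus>\<^bsub>V\<^esub> f x = f (\<ominus>\<^bsub>U\<^esub> x \<oplus>\<^bsub>U\<^esub> x)"
    by (rule D(2)[symmetric]) (use assms(4) in simp_all)
  also have "\<dots> = \<zero>\<^bsub>V\<^esub>"
    using assms(4) Hom_module_zero[OF assms(1-3)] by (simp add: U.M.l_neg)
  finally show ?thesis
    using assms(4) D(1) by (simp add: V.M.minus_equality)
qed

lemma card_fibre_eq_card_kernel: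
  assumes "module R U" "module R V" and f: "f \<in> carrier (Hom_module R U V)"
    and y: "y \<in> carrier U"
  shows "card {x \<in> carrier U. f x = f y} = card (a_kernel U V f)"
proof -
  interpret U: module R U by fact
  interpret V: module R V by fact
  note D = Hom_moduleD[OF f]
  have "bij_betw (\<lambda>x. y \<oplus>\<^bsub>U\<^esub> x) (a_kernel U V f) {x \<in> carrier U. f x = f y}"
  proof (rule bij_betw_byWitness[where f' = "\<lambda>x. \<ominus>\<^bsub>U\<^esub> y \<oplus>\<^bsub>U\<^esub> x"])
    show "\<forall>x\<in>a_kernel U V f. \<ominus>\<^bsub>U\<^esub> y \<oplus>\<^bsub>U\<^esub> (y \<oplus>\<^bsub>U\<^esub> x) = x"
      using y by (simp add: a_kernel_def' U.M.r_neg1)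
    show "\<forall>x\<in>{x \<in> carrier U. f x = f y}. y \<oplus>\<^bsub>U\<^esub> (\<ominus>\<^bsub>U\<^esub> y \<oplus>\<^bsub>U\<^esub> x) = x"
      using y by (simp add: U.M.r_neg2)
    show "(\<lambda>x. y \<oplus>\<^bsub>U\<^esub> x) ` a_kernel U V f \<subseteq> {x \<in> carrier U. f x = f y}"
      using y D(1) by (auto simp: a_kernel_def' D(2))
    show "(\<lambda>x. \<ominus>\<^bsub>U\<^esub> y \<oplus>\<^bsub>U\<^esub> x) ` {x \<in> carrier U. f x = f y} \<subseteq> a_kernel U V f"
      using y D(1) by (auto simp: a_kernel_def' D(2) Hom_module_minus[OF assms(1-3)] V.M.l_neg)
  qed
  then show ?thesis
    by (simp add: bij_betw_same_card)
qed

lemma card_eq_card_kernel_mult_card_image: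
  assumes "module R U" "module R V" "f \<in> carrier (Hom_module R U V)" "finite (carrier U)"
  shows "card (carrier U) = card (a_kernel U V f) * card (f ` carrier U)"
  by (rule card_eq_card_fibre_mult[where f = f])
    (use assms in \<open>auto simp: card_fibre_eq_card_kernel\<close>)

lemma submodule_image:
  assumes "module R U" "module R V" and f: "f \<in> carrier (Hom_module R U V)"
  shows "submodule (f ` carrier U) R V"
proof -
  interpret U: module R U by fact
  interpret V: module R V by fact
  note D = Hom_moduleD[OF f]
  show ?thesis
  proof (rule V.submoduleI)
    show "\<zero>\<^bsub>V\<^esub> \<in> f ` carrier U"
      using Hom_module_zero[OF assms] by force
    show "\<ominus>\<^bsub>V\<^esub> v \<in> f ` carrier U" if "v \<in> f ` carrier U" for v
      using that by (auto simp: Hom_module_minus[OF assms, symmetric])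
    show "v \<oplus>\<^bsub>V\<^esub> w \<in> f ` carrier U" if "v \<in> f ` carrier U" "w \<in> f ` carrier U" for v w
      using that by (auto simp: D(2)[symmetric])
    show "r \<odot>\<^bsub>V\<^esub> v \<in> f ` carrier U" if "r \<in> carrier R" "v \<in> f ` carrier U" for r v
      using that by (auto simp: D(3)[symmetric])
  qed (use D(1) in auto)
qed


section \<open>Rings with a nilpotent uniformiser\<close>

locale nilpotent_uniformiser = cring R for R (structure) +
  fixes \<pi>
  assumes uniformiser_closed [simp, intro]: "\<pi> \<in> carrier R"
    and nilpotent: "\<exists>n :: nat. \<pi> [^] n = \<zero>"
    and unit_or_multiple: "r \<in> carrier R \<Longrightarrow> r \<in> Units R \<or> (\<exists>s\<in>carrier R. r = \<pi> \<otimes> s)"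
begin

text \<open>The annihilator of the annihilator of \<open>\<pi>\<close> is \<open>\<pi>R\<close>, and this is what lets functionals extend. An element outside \<open>\<pi>R\<close> is a unit \<open>c\<close>, and if \<open>r\<pi> = 0\<close> implied \<open>rc = 0\<close>, then \<open>\<pi>\<close> would be
  cancellable; being nilpotent as well, it would force \<open>\<one> = \<zero>\<close>.\<close>

lemma multiple_if_annihilated:
  assumes c: "c \<in> carrier R" and ann: "\<And>r. \<lbrakk>r \<in> carrier R; r \<otimes> \<pi> = \<zero>\<rbrakk> \<Longrightarrow> r \<otimes> c = \<zero>"
  shows "\<exists>s\<in>carrier R. c = \<pi> \<otimes> s"
proof (rule ccontr)
  assume *: "\<not> (\<exists>s\<in>carrier R. c = \<pi> \<otimes> s)"
  then have u: "c \<in> Units R"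
    using unit_or_multiple[OF c] by blast
  have cancel: "r = \<zero>" if "r \<in> carrier R" "r \<otimes> \<pi> = \<zero>" for r
  proof -
    have "r = r \<otimes> c \<otimes> inv c"
      using that(1) c u by (simp add: m_assoc)
    also have "\<dots> = \<zero>"
      using ann[OF that] u by simp
    finally show ?thesis .
  qed
  have "\<pi> [^] n = \<zero> \<Longrightarrow> \<one> = \<zero>" for n :: nat
  proof (induction n)
    case (Suc n)
    then show ?case
      using cancel[of "\<pi> [^] n"] by simp
  qed simp
  then have "\<one> = \<zero>"
    using nilpotent by blast
  then have "c = \<pi> \<otimes> \<zero>"
    using c by (metis l_one l_null r_null uniformiser_closed)
  with * show False by blast
qed

end

text \<open>A nonzero nonunit has an irreducible divisor. That divisor generates a maximal ideal, which can
  only be \<open>P\<close>; so every nonunit lies in \<open>P\<close>.\<close>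

lemma (in discrete_valuation_ring) uniformiser:
  obtains p where "p \<in> P"
    and "\<And>d. d \<in> carrier R \<Longrightarrow> d \<in> Units R \<or> (\<exists>e\<in>carrier R. d = p \<otimes> e)"
proof -
  interpret P: maximalideal P R by (rule maximal)
  obtain p where p: "p \<in> carrier R" "P = PIdl p"
    using exists_gen[OF P.is_ideal] by blast
  have "d \<in> Units R \<or> (\<exists>e\<in>carrier R. d = p \<otimes> e)" if d: "d \<in> carrier R" for d
  proof (cases "d \<in> Units R \<or> d = \<zero>")
    case True
    have "\<zero> = p \<otimes> \<zero>"
      using p(1) by simp
    with True show ?thesis
      by blast
  next
    case False
    then have "d \<in> carrier R - {\<zero>}" "d \<notin> Units R"
      using d by auto
    then obtain q where q: "q \<in> carrier R" "ring_irreducible q" "q divides d"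
      by (rule exists_irreducible_divisor)
    have "PIdl q = P"
      by (rule maximal_unique[OF irreducible_imp_maximalideal[OF q(1,2)]])
    moreover obtain c where c: "c \<in> carrier R" "d = q \<otimes> c"
      using q(3) by (auto simp: factor_def)
    then have "d \<in> PIdl q"
      using m_comm[OF q(1) c(1)] unfolding cgenideal_def by blast
    ultimately have "d \<in> PIdl p"
      using p(2) by simp
    then obtain e where "e \<in> carrier R" "d = e \<otimes> p"
      unfolding cgenideal_def by blast
    then show ?thesis
      using m_comm[of e p] p(1) by blast
  qed
  moreover have "p \<in> P"
    unfolding p(2) by (rule cgenideal_self[OF p(1)])
  ultimately show thesis
    using that by blast
qed

text \<open>The image of a generator of \<open>P\<close> serves: its \<open>n\<close>-th power vanishes modulo \<open>P\<^sup>n\<close>, and the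
  dichotomy between units and multiples passes to any homomorphic image. For \<open>n = 0\<close> the ring is
  zero, where \<open>\<pi> = \<zero>\<close> is also a unit.\<close>

lemma truncated_dvr_imp_nilpotent_uniformiser:
  fixes R :: "('r, 'k) ring_scheme"
  assumes "truncated_dvr TYPE('d) R"
  shows "\<exists>\<pi>. nilpotent_uniformiser R \<pi>"
proof -
  obtain D :: "'d ring" and P and n :: nat where cr: "cring R"
    and dvr: "discrete_valuation_ring D P"
    and iso: "R \<simeq> D Quot (P [^]\<^bsub>ideals_set D\<^esub> n)"
    using assms unfolding truncated_dvr_def by blast
  interpret R: cring R by (rule cr)
  interpret D: discrete_valuation_ring D P by (rule dvr)
  interpret P: maximalideal P D by (rule D.maximal)
  interpret S: semiring "ideals_set D" by (rule D.ideals_set_is_semiring)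
  obtain p where p: "p \<in> P"
    and unit: "\<And>d. d \<in> carrier D \<Longrightarrow> d \<in> Units D \<or> (\<exists>e\<in>carrier D. d = p \<otimes>\<^bsub>D\<^esub> e)"
    using D.uniformiser by blast
  have pD: "p \<in> carrier D"
    using p by simp
  let ?I = "P [^]\<^bsub>ideals_set D\<^esub> n"
  have "P \<in> carrier (ideals_set D)"
    by (simp add: ideals_set_def P.is_ideal)
  then have "?I \<in> carrier (ideals_set D)"
    by simp
  then interpret I: ideal ?I D
    by (simp add: ideals_set_def)
  have pn: "p [^]\<^bsub>D\<^esub> m \<in> P [^]\<^bsub>ideals_set D\<^esub> m" for m :: nat
  proof (induction m)
    case 0
    then show ?case by (simp add: ideals_set_def)
  next
    case (Suc m)
    then show ?case
      using p by (simp add: ideals_set_def ideal_prod.prod)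
  qed
  obtain g where g: "g \<in> ring_iso (D Quot ?I) R"
    using iso ring_iso_set_sym[OF R.ring_axioms] unfolding is_ring_iso_def by blast
  define h where "h = g \<circ> (\<lambda>d. ?I +>\<^bsub>D\<^esub> d)"
  have h: "h \<in> ring_hom D R"
    unfolding h_def using ring_hom_trans[OF I.rcos_ring_hom] g by (auto simp: ring_iso_def)
  interpret h: ring_hom_cring D R h
    by unfold_locales (rule h)
  have surj: "h ` carrier D = carrier R"
  proof -
    have "(\<lambda>d. ?I +>\<^bsub>D\<^esub> d) ` carrier D = carrier (D Quot ?I)"
      by (auto simp: FactRing_def A_RCOSETS_def')
    then have "h ` carrier D = g ` carrier (D Quot ?I)"
      unfolding h_def by (metis image_comp)
    then show ?thesis
      using g by (simp add: ring_iso_def bij_betw_def)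
  qed
  have "h (p [^]\<^bsub>D\<^esub> n) = \<zero>\<^bsub>R\<^esub>"
  proof -
    have "?I +>\<^bsub>D\<^esub> (p [^]\<^bsub>D\<^esub> n) = ?I +>\<^bsub>D\<^esub> \<zero>\<^bsub>D\<^esub>"
      using pn[of n] by (simp add: I.a_rcos_const)
    then show ?thesis
      using h.hom_zero unfolding h_def by simp
  qed
  moreover have "h (p [^]\<^bsub>D\<^esub> m) = h p [^]\<^bsub>R\<^esub> m" for m :: nat
    by (induction m) (simp_all add: pD)
  ultimately have nil: "h p [^]\<^bsub>R\<^esub> n = \<zero>\<^bsub>R\<^esub>"
    by simp
  have "r \<in> Units R \<or> (\<exists>s\<in>carrier R. r = h p \<otimes>\<^bsub>R\<^esub> s)" if r: "r \<in> carrier R" for r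
  proof -
    obtain d where d: "d \<in> carrier D" "r = h d"
      using r surj by blast
    from unit[OF d(1)] show ?thesis
    proof
      assume u: "d \<in> Units D"
      then have "h d \<otimes>\<^bsub>R\<^esub> h (inv\<^bsub>D\<^esub> d) = \<one>\<^bsub>R\<^esub>"
        using d(1) by (simp add: h.hom_mult[symmetric])
      moreover have "h (inv\<^bsub>D\<^esub> d) \<in> carrier R"
        using u by simp
      ultimately show ?thesis
        using d(2) R.divides_one[OF r] unfolding factor_def by metis
    next
      assume "\<exists>e\<in>carrier D. d = p \<otimes>\<^bsub>D\<^esub> e"
      then show ?thesis
        using d pD by auto
    qed
  qed
  then have "nilpotent_uniformiser R (h p)"
    using nil pD by unfold_locales auto
  then show ?thesis ..
qed


section \<open>Extending functionals by one generator\<close>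

definition adjoin :: "('r, 'k) ring_scheme \<Rightarrow> ('r, 'w, 'l) module_scheme \<Rightarrow> 'w set \<Rightarrow> 'w \<Rightarrow> 'w set"
  where "adjoin R W N w = (\<lambda>(y, r). y \<oplus>\<^bsub>W\<^esub> r \<odot>\<^bsub>W\<^esub> w) ` (N \<times> carrier R)"

text \<open>Replacing the carrier of \<open>W\<close> turns a submodule into a module record, so that \<open>dual_module\<close>
  applies to it.\<close>

definition functionals ::
    "('r, 'k) ring_scheme \<Rightarrow> ('r, 'w, 'l) module_scheme \<Rightarrow> 'w set \<Rightarrow> ('w \<Rightarrow> 'r) set"
  where "functionals R W N = carrier (dual_module R (W\<lparr>carrier := N\<rparr>))"

lemma functionals_iff:
  "f \<in> functionals R W N \<longleftrightarrow> f \<in> N \<rightarrow>\<^sub>E carrier R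
    \<and> (\<forall>x\<in>N. \<forall>y\<in>N. f (x \<oplus>\<^bsub>W\<^esub> y) = f x \<oplus>\<^bsub>R\<^esub> f y)
    \<and> (\<forall>r\<in>carrier R. \<forall>x\<in>N. f (r \<odot>\<^bsub>W\<^esub> x) = r \<otimes>\<^bsub>R\<^esub> f x)"
  by (simp add: functionals_def dual_module_def Hom_module_def regular_module_def)

lemma functionalsD:
  assumes "f \<in> functionals R W N"
  shows "\<And>x. x \<in> N \<Longrightarrow> f x \<in> carrier R"
    and "\<And>x y. \<lbrakk>x \<in> N; y \<in> N\<rbrakk> \<Longrightarrow> f (x \<oplus>\<^bsub>W\<^esub> y) = f x \<oplus>\<^bsub>R\<^esub> f y"
    and "\<And>r x. \<lbrakk>r \<in> carrier R; x \<in> N\<rbrakk> \<Longrightarrow> f (r \<odot>\<^bsub>W\<^esub> x) = r \<otimes>\<^bsub>R\<^esub> f x"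
    and "f \<in> extensional N"
  using assms by (auto simp: functionals_iff PiE_iff)

lemma functionalsI:
  assumes "f \<in> extensional N"
    and "\<And>x. x \<in> N \<Longrightarrow> f x \<in> carrier R"
    and "\<And>x y. \<lbrakk>x \<in> N; y \<in> N\<rbrakk> \<Longrightarrow> f (x \<oplus>\<^bsub>W\<^esub> y) = f x \<oplus>\<^bsub>R\<^esub> f y"
    and "\<And>r x. \<lbrakk>r \<in> carrier R; x \<in> N\<rbrakk> \<Longrightarrow> f (r \<odot>\<^bsub>W\<^esub> x) = r \<otimes>\<^bsub>R\<^esub> f x"
  shows "f \<in> functionals R W N"
  using assms by (simp add: functionals_iff PiE_iff)

lemma finite_functionals:
  assumes "finite N" "finite (carrier R)"
  shows "finite (functionals R W N)"
  by (rule finite_subset[OF _ finite_PiE[of N "\<lambda>_. carrier R"]]) (use assms in \<open>auto simp: functionals_iff\<close>)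

lemma restrict_functional:
  assumes "N \<subseteq> N'" "f \<in> functionals R W N'" "submodule N R W"
  shows "restrict f N \<in> functionals R W N"
proof -
  interpret submodule N R W by fact
  show ?thesis
    by (rule functionalsI)
      (use assms functionalsD[OF assms(2)] m_closed in \<open>auto simp: subset_iff\<close>)
qed

text \<open>The step from \<open>N\<close> to \<open>N + Rw\<close>, whose quotient \<open>(N + Rw) / N\<close> is isomorphic to \<open>R / \<pi>R\<close>.\<close>

locale one_generator_extension =
  nilpotent_uniformiser R \<pi> + W: module R W
  for R :: "('r, 'k) ring_scheme" (structure) and \<pi> and W :: "('r, 'w, 'l) module_scheme" +
  fixes N w
  assumes submodule: "submodule N R W"
    and w: "w \<in> carrier W" "w \<notin> N" "\<pi> \<odot>\<^bsub>W\<^esub> w \<in> N"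
begin

lemmas N_closed = W.submoduleE(3-5)[OF submodule]

lemma N_sub: "y \<in> N \<Longrightarrow> y \<in> carrier W"
  using W.submoduleE(1)[OF submodule] by blast

lemma N_zero: "\<zero>\<^bsub>W\<^esub> \<in> N"
  using subgroup.one_closed[OF submodule.axioms(1)[OF submodule]] by simp

text \<open>A unit multiple of \<open>w\<close> is not in \<open>N\<close>, because dividing by the unit would put \<open>w\<close> there.\<close>

lemma coefficient_multiple:
  assumes r: "r \<in> carrier R" and rw: "r \<odot>\<^bsub>W\<^esub> w \<in> N"
  shows "\<exists>s\<in>carrier R. r = \<pi> \<otimes> s"
proof -
  have "r \<notin> Units R"
  proof
    assume u: "r \<in> Units R"
    then have "inv r \<odot>\<^bsub>W\<^esub> (r \<odot>\<^bsub>W\<^esub> w) = w"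
      using r w(1) by (simp add: W.smult_assoc1[symmetric])
    then show False
      using N_closed(2)[OF _ rw, of "inv r"] u w(2) by simp
  qed
  then show ?thesis
    using unit_or_multiple[OF r] by blast
qed

text \<open>The representation of an element of \<open>N + Rw\<close> as \<open>y + rw\<close> is unique up to moving a multiple of
  \<open>\<pi>w\<close> between the two summands. Both the size of \<open>N + Rw\<close> and the well-definedness of extensions
  follow from this.\<close>

lemma coefficient_difference:
  assumes y: "y \<in> N" "y' \<in> N" and r: "r \<in> carrier R" "r' \<in> carrier R"
    and eq: "y \<oplus>\<^bsub>W\<^esub> r \<odot>\<^bsub>W\<^esub> w = y' \<oplus>\<^bsub>W\<^esub> r' \<odot>\<^bsub>W\<^esub> w"
  obtains s where "s \<in> carrier R" "r = r' \<oplus> \<pi> \<otimes> s"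
    "y' = y \<oplus>\<^bsub>W\<^esub> (\<pi> \<otimes> s) \<odot>\<^bsub>W\<^esub> w"
proof -
  note [simp] = N_sub[OF y(1)] N_sub[OF y(2)] r w(1)
  have *: "y' = y \<oplus>\<^bsub>W\<^esub> (r \<ominus> r') \<odot>\<^bsub>W\<^esub> w"
  proof -
    have "y' = (y' \<oplus>\<^bsub>W\<^esub> r' \<odot>\<^bsub>W\<^esub> w) \<oplus>\<^bsub>W\<^esub> \<ominus>\<^bsub>W\<^esub> (r' \<odot>\<^bsub>W\<^esub> w)"
      by (simp add: W.M.a_assoc W.M.r_neg)
    also have "\<dots> = y \<oplus>\<^bsub>W\<^esub> (r \<ominus> r') \<odot>\<^bsub>W\<^esub> w"
      by (simp add: eq[symmetric] minus_eq W.smult_l_distr W.smult_l_minus W.M.a_assoc)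
    finally show ?thesis .
  qed
  have "(r \<ominus> r') \<odot>\<^bsub>W\<^esub> w = \<ominus>\<^bsub>W\<^esub> y \<oplus>\<^bsub>W\<^esub> y'"
    by (simp add: * W.M.r_neg1)
  then have "(r \<ominus> r') \<odot>\<^bsub>W\<^esub> w \<in> N"
    using y N_closed by simp
  then obtain s where s: "s \<in> carrier R" "r \<ominus> r' = \<pi> \<otimes> s"
    using coefficient_multiple[of "r \<ominus> r'"] by auto
  have "r = r' \<oplus> (r \<ominus> r')"
    by (simp add: minus_eq r_neg2 a_lcomm r_neg)
  then show thesis
    using that s * by simp
qed

lemma submodule_adjoin: "submodule (adjoin R W N w) R W"
proof (rule W.submoduleI)
  show "adjoin R W N w \<subseteq> carrier W"
    using N_sub w(1) by (auto simp: adjoin_def)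
  have "\<zero>\<^bsub>W\<^esub> = \<zero>\<^bsub>W\<^esub> \<oplus>\<^bsub>W\<^esub> \<zero> \<odot>\<^bsub>W\<^esub> w"
    using w(1) by simp
  then show "\<zero>\<^bsub>W\<^esub> \<in> adjoin R W N w"
    using N_zero unfolding adjoin_def by force
next
  fix z assume "z \<in> adjoin R W N w"
  then obtain y r where z: "y \<in> N" "r \<in> carrier R" "z = y \<oplus>\<^bsub>W\<^esub> r \<odot>\<^bsub>W\<^esub> w"
    by (auto simp: adjoin_def)
  have "\<ominus>\<^bsub>W\<^esub> z = \<ominus>\<^bsub>W\<^esub> y \<oplus>\<^bsub>W\<^esub> (\<ominus> r) \<odot>\<^bsub>W\<^esub> w"
    using z N_sub w(1) by (simp add: W.M.minus_add W.smult_l_minus)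
  then show "\<ominus>\<^bsub>W\<^esub> z \<in> adjoin R W N w"
    using z N_closed(1)[OF z(1)] unfolding adjoin_def by force
  {
    fix z' assume "z' \<in> adjoin R W N w"
    then obtain y' r' where z': "y' \<in> N" "r' \<in> carrier R" "z' = y' \<oplus>\<^bsub>W\<^esub> r' \<odot>\<^bsub>W\<^esub> w"
      by (auto simp: adjoin_def)
    have "z \<oplus>\<^bsub>W\<^esub> z' = (y \<oplus>\<^bsub>W\<^esub> y') \<oplus>\<^bsub>W\<^esub> (r \<oplus> r') \<odot>\<^bsub>W\<^esub> w"
      using z z' N_sub w(1) by (simp add: W.smult_l_distr W.M.a_ac)
    then show "z \<oplus>\<^bsub>W\<^esub> z' \<in> adjoin R W N w"
      using z z' N_closed(3)[OF z(1) z'(1)] unfolding adjoin_def by force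
  }
  fix a assume a: "a \<in> carrier R"
  have "a \<odot>\<^bsub>W\<^esub> z = (a \<odot>\<^bsub>W\<^esub> y) \<oplus>\<^bsub>W\<^esub> (a \<otimes> r) \<odot>\<^bsub>W\<^esub> w"
    using a z N_sub w(1) by (simp add: W.smult_r_distr W.smult_assoc1)
  then show "a \<odot>\<^bsub>W\<^esub> z \<in> adjoin R W N w"
    using a z N_closed(2)[OF a z(1)] unfolding adjoin_def by force
qed

lemma subset_adjoin: "N \<subseteq> adjoin R W N w"
proof
  fix y assume y: "y \<in> N"
  then have "y = y \<oplus>\<^bsub>W\<^esub> \<zero> \<odot>\<^bsub>W\<^esub> w"
    using w(1) N_sub by simp
  then show "y \<in> adjoin R W N w"
    using y unfolding adjoin_def by force
qed

lemma generator_in_adjoin: "w \<in> adjoin R W N w"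
proof -
  have "w = \<zero>\<^bsub>W\<^esub> \<oplus>\<^bsub>W\<^esub> \<one> \<odot>\<^bsub>W\<^esub> w"
    using w(1) by simp
  then show ?thesis
    using N_zero unfolding adjoin_def by force
qed

text \<open>By the ambiguity just described, each element of \<open>N + Rw\<close> has \<open>|\<pi>R|\<close> representations.\<close>

lemma card_adjoin:
  assumes "finite (carrier R)" "finite (carrier W)"
  shows "card N * card (carrier R) = card ((\<lambda>s. \<pi> \<otimes> s) ` carrier R) * card (adjoin R W N w)"
proof -
  let ?f = "\<lambda>(y, r). y \<oplus>\<^bsub>W\<^esub> r \<odot>\<^bsub>W\<^esub> w" and ?P = "(\<lambda>s. \<pi> \<otimes> s) ` carrier R"
  have fN: "finite N"
    using assms(2) N_sub by (meson finite_subset subsetI)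
  have "card (N \<times> carrier R) = card ?P * card (adjoin R W N w)"
  proof (rule card_eq_card_fibre_mult[where f = ?f])
    fix z assume "z \<in> adjoin R W N w"
    then obtain y r where z: "y \<in> N" "r \<in> carrier R" "z = y \<oplus>\<^bsub>W\<^esub> r \<odot>\<^bsub>W\<^esub> w"
      by (auto simp: adjoin_def)
    \<comment> \<open>Moving \<open>tw\<close> from the first summand to the second, for \<open>t \<in> \<pi>R\<close>.\<close>
    let ?g = "\<lambda>t. (y \<oplus>\<^bsub>W\<^esub> \<ominus>\<^bsub>W\<^esub> (t \<odot>\<^bsub>W\<^esub> w), r \<oplus> t)"
    have "bij_betw ?g ?P {q \<in> N \<times> carrier R. ?f q = z}"
      unfolding bij_betw_def
    proof
      show "inj_on ?g ?P"
        using z(2) by (auto intro!: inj_onI)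
      show "?g ` ?P = {q \<in> N \<times> carrier R. ?f q = z}"
      proof (intro subset_antisym subsetI)
        fix q assume "q \<in> ?g ` ?P"
        then obtain s where s: "s \<in> carrier R" "q = ?g (\<pi> \<otimes> s)"
          by auto
        have "(\<pi> \<otimes> s) \<odot>\<^bsub>W\<^esub> w = s \<odot>\<^bsub>W\<^esub> (\<pi> \<odot>\<^bsub>W\<^esub> w)"
          using s w(1) by (simp add: m_comm W.smult_assoc1[symmetric])
        then have "(\<pi> \<otimes> s) \<odot>\<^bsub>W\<^esub> w \<in> N"
          using s w(3) N_closed by simp
        moreover have "?f q = z"
          using s z w(1) N_sub
          by (simp add: W.smult_l_distr W.M.a_assoc W.M.r_neg1
              W.M.a_comm[of "r \<odot>\<^bsub>W\<^esub> w" "(\<pi> \<otimes> s) \<odot>\<^bsub>W\<^esub> w"])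
        ultimately show "q \<in> {q \<in> N \<times> carrier R. ?f q = z}"
          using s z N_closed by simp
      next
        fix q assume "q \<in> {q \<in> N \<times> carrier R. ?f q = z}"
        then obtain y' r' where q: "q = (y', r')" "y' \<in> N" "r' \<in> carrier R"
          "y' \<oplus>\<^bsub>W\<^esub> r' \<odot>\<^bsub>W\<^esub> w = y \<oplus>\<^bsub>W\<^esub> r \<odot>\<^bsub>W\<^esub> w"
          using z by auto
        then obtain s where s: "s \<in> carrier R" "r' = r \<oplus> \<pi> \<otimes> s"
          "y = y' \<oplus>\<^bsub>W\<^esub> (\<pi> \<otimes> s) \<odot>\<^bsub>W\<^esub> w"
          using coefficient_difference[of y' y r' r] z by metis
        have "q = ?g (\<pi> \<otimes> s)"
          using q s w(1) N_sub by (simp add: W.M.a_assoc W.M.r_neg)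
        then show "q \<in> ?g ` ?P"
          using s(1) by blast
      qed
    qed
    then show "card {q \<in> N \<times> carrier R. ?f q = z} = card ?P"
      by (rule bij_betw_same_card[THEN sym])
  qed (auto simp: adjoin_def fN assms)
  then show ?thesis
    by (simp add: card_cartesian_product)
qed

lemma adjoin_cases:
  assumes "z \<in> adjoin R W N w"
  obtains y r where "y \<in> N" "r \<in> carrier R" "z = y \<oplus>\<^bsub>W\<^esub> r \<odot>\<^bsub>W\<^esub> w"
  using assms by (auto simp: adjoin_def)

lemma adjoin_memI: "\<lbrakk>y \<in> N; r \<in> carrier R\<rbrakk> \<Longrightarrow> y \<oplus>\<^bsub>W\<^esub> r \<odot>\<^bsub>W\<^esub> w \<in> adjoin R W N w"
  unfolding adjoin_def by force

lemma functional_on_adjoin: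
  assumes g: "g \<in> functionals R W (adjoin R W N w)" and y: "y \<in> N" and r: "r \<in> carrier R"
  shows "g (y \<oplus>\<^bsub>W\<^esub> r \<odot>\<^bsub>W\<^esub> w) = g y \<oplus> r \<otimes> g w"
proof -
  have "y \<in> adjoin R W N w" "r \<odot>\<^bsub>W\<^esub> w \<in> adjoin R W N w"
    using y subset_adjoin W.submoduleE(4)[OF submodule_adjoin r generator_in_adjoin] by auto
  then show ?thesis
    using functionalsD(2,3)[OF g] generator_in_adjoin r by simp
qed

text \<open>The extension sends \<open>y + rw\<close> to \<open>f y + rd\<close>. Two representations differ by moving \<open>\<pi>sw\<close>, which
  changes the two summands by \<open>f (s(\<pi>w))\<close> and \<open>s\<pi>d\<close>, and these agree by the choice of \<open>d\<close>.\<close>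

lemma extension_exists:
  assumes f: "f \<in> functionals R W N" and d: "d \<in> carrier R" and eq: "\<pi> \<otimes> d = f (\<pi> \<odot>\<^bsub>W\<^esub> w)"
  obtains g where "g \<in> functionals R W (adjoin R W N w)" "\<And>y. y \<in> N \<Longrightarrow> g y = f y" "g w = d"
proof -
  note D = functionalsD[OF f]
  let ?N' = "adjoin R W N w"
  let ?P = "\<lambda>z v. \<exists>y\<in>N. \<exists>r\<in>carrier R. z = y \<oplus>\<^bsub>W\<^esub> r \<odot>\<^bsub>W\<^esub> w \<and> v = f y \<oplus> r \<otimes> d"
  define g where "g = (\<lambda>z\<in>?N'. SOME v. ?P z v)"
  have g: "g (y \<oplus>\<^bsub>W\<^esub> r \<odot>\<^bsub>W\<^esub> w) = f y \<oplus> r \<otimes> d" if y: "y \<in> N" and r: "r \<in> carrier R" for y r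
  proof -
    have "(SOME v. ?P (y \<oplus>\<^bsub>W\<^esub> r \<odot>\<^bsub>W\<^esub> w) v) = f y \<oplus> r \<otimes> d"
    proof (rule some_equality)
      show "?P (y \<oplus>\<^bsub>W\<^esub> r \<odot>\<^bsub>W\<^esub> w) (f y \<oplus> r \<otimes> d)"
        using y r by blast
      fix v assume "?P (y \<oplus>\<^bsub>W\<^esub> r \<odot>\<^bsub>W\<^esub> w) v"
      then obtain y' r' where v: "y' \<in> N" "r' \<in> carrier R" "v = f y' \<oplus> r' \<otimes> d"
        and "y \<oplus>\<^bsub>W\<^esub> r \<odot>\<^bsub>W\<^esub> w = y' \<oplus>\<^bsub>W\<^esub> r' \<odot>\<^bsub>W\<^esub> w"
        by blast
      then obtain s where s: "s \<in> carrier R" "r = r' \<oplus> \<pi> \<otimes> s"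
        "y' = y \<oplus>\<^bsub>W\<^esub> (\<pi> \<otimes> s) \<odot>\<^bsub>W\<^esub> w"
        using coefficient_difference[of y y' r r'] y r by metis
      have ps: "(\<pi> \<otimes> s) \<odot>\<^bsub>W\<^esub> w = s \<odot>\<^bsub>W\<^esub> (\<pi> \<odot>\<^bsub>W\<^esub> w)"
        using s w(1) by (simp add: m_comm W.smult_assoc1[symmetric])
      have "f y' = f y \<oplus> s \<otimes> (\<pi> \<otimes> d)"
        unfolding s(3) ps using y s(1) w(3) N_closed by (simp add: D(2,3) eq)
      then show "v = f y \<oplus> r \<otimes> d"
        unfolding v(3) using y d s v(2) D(1)[OF y]
        by (simp add: l_distr r_distr m_ac a_ac)
    qed
    then show ?thesis
      unfolding g_def using adjoin_memI[OF y r] by simp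
  qed
  have "g \<in> functionals R W ?N'"
  proof (rule functionalsI)
    show "g \<in> extensional ?N'"
      by (simp add: g_def)
    fix z assume "z \<in> ?N'"
    then obtain y r where z: "y \<in> N" "r \<in> carrier R" "z = y \<oplus>\<^bsub>W\<^esub> r \<odot>\<^bsub>W\<^esub> w"
      by (rule adjoin_cases)
    show "g z \<in> carrier R"
      using z d D(1) by (simp add: g)
    {
      fix z' assume "z' \<in> ?N'"
      then obtain y' r' where z': "y' \<in> N" "r' \<in> carrier R" "z' = y' \<oplus>\<^bsub>W\<^esub> r' \<odot>\<^bsub>W\<^esub> w"
        by (rule adjoin_cases)
      have "z \<oplus>\<^bsub>W\<^esub> z' = (y \<oplus>\<^bsub>W\<^esub> y') \<oplus>\<^bsub>W\<^esub> (r \<oplus> r') \<odot>\<^bsub>W\<^esub> w"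
        using z z' N_sub w(1) by (simp add: W.smult_l_distr W.M.a_ac)
      then show "g (z \<oplus>\<^bsub>W\<^esub> z') = g z \<oplus> g z'"
        using z z' d D(1) N_closed by (simp add: g D(2) l_distr a_ac)
    }
    fix a assume a: "a \<in> carrier R"
    have "a \<odot>\<^bsub>W\<^esub> z = (a \<odot>\<^bsub>W\<^esub> y) \<oplus>\<^bsub>W\<^esub> (a \<otimes> r) \<odot>\<^bsub>W\<^esub> w"
      using a z N_sub w(1) by (simp add: W.smult_r_distr W.smult_assoc1)
    then show "g (a \<odot>\<^bsub>W\<^esub> z) = a \<otimes> g z"
      using a z d D(1) N_closed by (simp add: g D(3) r_distr m_assoc)
  qed
  moreover have "g y = f y" if "y \<in> N" for y
    using g[OF that, of \<zero>] that d D(1) N_sub w(1) by simp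
  moreover have "g w = d"
  proof -
    have "f \<zero>\<^bsub>W\<^esub> = \<zero>"
      using D(3)[of \<zero> "\<zero>\<^bsub>W\<^esub>"] D(1)[OF N_zero] N_zero by simp
    then show ?thesis
      using g[OF N_zero, of \<one>] d w(1) by simp
  qed
  ultimately show thesis
    using that by blast
qed

lemma extension_values:
  assumes f: "f \<in> functionals R W N"
  shows "bij_betw (\<lambda>g. g w)
    {g \<in> functionals R W (adjoin R W N w). restrict g N = f}
    {d \<in> carrier R. \<pi> \<otimes> d = f (\<pi> \<odot>\<^bsub>W\<^esub> w)}" (is "bij_betw _ ?G ?D")
  unfolding bij_betw_def
proof
  let ?N' = "adjoin R W N w"
  show "inj_on (\<lambda>g. g w) ?G"
  proof (rule inj_onI)
    fix g h assume g: "g \<in> ?G" and h: "h \<in> ?G" and eq: "g w = h w"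
    show "g = h"
    proof (rule extensionalityI[where A = ?N'])
      show "g \<in> extensional ?N'" "h \<in> extensional ?N'"
        using g h functionalsD(4) by auto
      fix z assume "z \<in> ?N'"
      then obtain y r where z: "y \<in> N" "r \<in> carrier R" "z = y \<oplus>\<^bsub>W\<^esub> r \<odot>\<^bsub>W\<^esub> w"
        by (rule adjoin_cases)
      have "g y = h y"
        using g h z(1) by (metis (mono_tags, lifting) mem_Collect_eq restrict_apply')
      then show "g z = h z"
        using g h z eq by (simp add: functional_on_adjoin)
    qed
  qed
  show "(\<lambda>g. g w) ` ?G = ?D"
  proof (intro subset_antisym subsetI)
    fix d assume "d \<in> (\<lambda>g. g w) ` ?G"
    then obtain g where g: "g \<in> functionals R W ?N'" "restrict g N = f" "d = g w"
      by blast
    have "g (\<pi> \<odot>\<^bsub>W\<^esub> w) = f (\<pi> \<odot>\<^bsub>W\<^esub> w)"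
      using g(2) w(3) by auto
    then show "d \<in> ?D"
      using functionalsD(1,3)[OF g(1)] generator_in_adjoin g(3) by simp
  next
    fix d assume "d \<in> ?D"
    then obtain g where g: "g \<in> functionals R W ?N'" "\<And>y. y \<in> N \<Longrightarrow> g y = f y" "g w = d"
      using extension_exists[OF f, of d] by blast
    have "restrict g N = f"
      by (rule extensionalityI[where A = N]) (use g(2) functionalsD(4)[OF f] in auto)
    then show "d \<in> (\<lambda>g. g w) ` ?G"
      using g by blast
  qed
qed

text \<open>If \<open>r\<pi> = 0\<close>, then \<open>r f(\<pi>w) = f(r\<pi>w) = 0\<close>.\<close>

lemma value_is_multiple:
  assumes f: "f \<in> functionals R W N"
  shows "\<exists>d\<in>carrier R. f (\<pi> \<odot>\<^bsub>W\<^esub> w) = \<pi> \<otimes> d"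
proof (rule multiple_if_annihilated)
  note D = functionalsD[OF f]
  show "f (\<pi> \<odot>\<^bsub>W\<^esub> w) \<in> carrier R"
    by (rule D(1)[OF w(3)])
  fix r assume r: "r \<in> carrier R" "r \<otimes> \<pi> = \<zero>"
  have "r \<otimes> f (\<pi> \<odot>\<^bsub>W\<^esub> w) = f ((r \<otimes> \<pi>) \<odot>\<^bsub>W\<^esub> w)"
    using r(1) w D(3) by (simp add: W.smult_assoc1)
  also have "\<dots> = f (\<zero> \<odot>\<^bsub>W\<^esub> \<zero>\<^bsub>W\<^esub>)"
    using r w by simp
  also have "\<dots> = \<zero>"
    using D(3)[of \<zero> "\<zero>\<^bsub>W\<^esub>"] D(1)[OF N_zero] N_zero by simp
  finally show "r \<otimes> f (\<pi> \<odot>\<^bsub>W\<^esub> w) = \<zero>" .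
qed

lemma multiplication_Hom:
  "(\<lambda>r\<in>carrier R. \<pi> \<otimes> r) \<in> carrier (Hom_module R (regular_module R) (regular_module R))"
  using restrict_mem_Hom_module[OF module_regular_module[OF is_cring],
      of "\<lambda>r. \<pi> \<otimes> r" "regular_module R"]
  by (simp add: regular_module_def r_distr m_lcomm)

lemma card_extensions:
  assumes f: "f \<in> functionals R W N"
  shows "card {g \<in> functionals R W (adjoin R W N w). restrict g N = f}
    = card {r \<in> carrier R. \<pi> \<otimes> r = \<zero>}"
proof -
  obtain d0 where d0: "d0 \<in> carrier R" "f (\<pi> \<odot>\<^bsub>W\<^esub> w) = \<pi> \<otimes> d0"
    using value_is_multiple[OF f] by blast
  have reg: "module R (regular_module R)"
    by (rule module_regular_module[OF is_cring])
  have "{d \<in> carrier R. \<pi> \<otimes> d = \<pi> \<otimes> d0}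
      = {x \<in> carrier (regular_module R). (\<lambda>r\<in>carrier R. \<pi> \<otimes> r) x = (\<lambda>r\<in>carrier R. \<pi> \<otimes> r) d0}"
    using d0 by (auto simp: regular_module_def)
  moreover have "{r \<in> carrier R. \<pi> \<otimes> r = \<zero>}
      = a_kernel (regular_module R) (regular_module R) (\<lambda>r\<in>carrier R. \<pi> \<otimes> r)"
    by (auto simp: a_kernel_def' regular_module_def)
  moreover have "d0 \<in> carrier (regular_module R)"
    using d0 by (simp add: regular_module_def)
  ultimately have "card {d \<in> carrier R. \<pi> \<otimes> d = \<pi> \<otimes> d0} = card {r \<in> carrier R. \<pi> \<otimes> r = \<zero>}"
    using card_fibre_eq_card_kernel[OF reg reg multiplication_Hom, of d0] by simp
  then show ?thesis
    using bij_betw_same_card[OF extension_values[OF f]] d0(2) by simp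
qed

text \<open>Restriction to \<open>N\<close> has fibres of size \<open>|ann \<pi>|\<close>, and \<open>|ann \<pi>| |\<pi>R| = |R|\<close> because
  multiplication by \<open>\<pi>\<close> is a homomorphism; the factor \<open>|\<pi>R|\<close> then cancels against \<open>card_adjoin\<close>.\<close>

lemma card_vanishing_functionals_adjoin:
  assumes fin: "finite (carrier R)" "finite (carrier W)" and N0: "N\<^sub>0 \<subseteq> N"
  shows "card {g \<in> functionals R W (adjoin R W N w). \<forall>y\<in>N\<^sub>0. g y = \<zero>} * card N
    = card {f \<in> functionals R W N. \<forall>y\<in>N\<^sub>0. f y = \<zero>} * card (adjoin R W N w)"
    (is "card ?G * _ = card ?F * card ?N'")
proof -
  let ?k = "card {r \<in> carrier R. \<pi> \<otimes> r = \<zero>}" and ?m = "card ((\<lambda>s. \<pi> \<otimes> s) ` carrier R)"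
  have finN': "finite ?N'"
    using W.submoduleE(1)[OF submodule_adjoin] fin(2) finite_subset by blast
  have finN: "finite N"
    using subset_adjoin finN' finite_subset by blast
  have "card ?G = ?k * card ?F"
  proof (rule card_eq_card_fibre_mult[where f = "\<lambda>g. restrict g N"])
    show "finite ?G" "finite ?F"
      using finite_functionals[OF finN' fin(1), of W] finite_functionals[OF finN fin(1), of W] by auto
    show "(\<lambda>g. restrict g N) ` ?G \<subseteq> ?F"
      using restrict_functional[OF subset_adjoin _ submodule] N0 by auto
    fix f assume f: "f \<in> ?F"
    then have "{g \<in> ?G. restrict g N = f}
        = {g \<in> functionals R W ?N'. restrict g N = f}"
      using N0 by (force simp: subset_iff)
    then show "card {g \<in> ?G. restrict g N = f} = ?k"
      using card_extensions f by simp
  qed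
  moreover have "card (carrier R) = ?k * ?m"
  proof -
    let ?p = "\<lambda>r\<in>carrier R. \<pi> \<otimes> r"
    have reg: "module R (regular_module R)"
      by (rule module_regular_module[OF is_cring])
    have "a_kernel (regular_module R) (regular_module R) ?p = {r \<in> carrier R. \<pi> \<otimes> r = \<zero>}"
      by (auto simp: a_kernel_def' regular_module_def)
    moreover have "?p ` carrier R = (\<lambda>s. \<pi> \<otimes> s) ` carrier R"
      by simp
    ultimately show ?thesis
      using card_eq_card_kernel_mult_card_image[OF reg reg multiplication_Hom] fin(1)
      by (simp add: regular_module_def)
  qed
  moreover have "?m > 0"
    using fin(1) zero_closed by (auto simp: card_gt_0_iff)
  ultimately have "card ?G * card N * ?m = card ?F * card ?N' * ?m"
    using card_adjoin[OF fin] by (simp add: mult_ac)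
  then show ?thesis
    using \<open>?m > 0\<close> by simp
qed

end

text \<open>Start from any element outside \<open>N\<close> and stop multiplying by \<open>\<pi>\<close> just before it enters \<open>N\<close>.\<close>

lemma (in nilpotent_uniformiser) minimal_generator_exists:
  assumes "module R W" "submodule N R W" "N \<noteq> carrier W"
  obtains w where "w \<in> carrier W" "w \<notin> N" "\<pi> \<odot>\<^bsub>W\<^esub> w \<in> N"
proof -
  interpret W: module R W by fact
  have sub: "N \<subseteq> carrier W"
    using W.submoduleE(1)[OF assms(2)] .
  obtain u where u: "u \<in> carrier W" "u \<notin> N"
    using sub assms(3) by blast
  obtain n :: nat where n: "\<pi> [^] n = \<zero>"
    using nilpotent by blast
  have "\<pi> [^] n \<odot>\<^bsub>W\<^esub> u \<in> N"
    using n u(1) subgroup.one_closed[OF submodule.axioms(1)[OF assms(2)]] by simp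
  moreover have "\<pi> [^] (0 :: nat) \<odot>\<^bsub>W\<^esub> u \<notin> N"
    using u by simp
  \<comment> \<open>The last exponent before the powers of \<open>\<pi>\<close> carry \<open>u\<close> into \<open>N\<close>.\<close>
  ultimately obtain k :: nat where k: "\<pi> [^] k \<odot>\<^bsub>W\<^esub> u \<notin> N" "\<pi> [^] Suc k \<odot>\<^bsub>W\<^esub> u \<in> N"
    using exists_least_lemma[of "\<lambda>k :: nat. \<pi> [^] k \<odot>\<^bsub>W\<^esub> u \<in> N"] by blast
  have "\<pi> [^] Suc k \<odot>\<^bsub>W\<^esub> u = \<pi> \<odot>\<^bsub>W\<^esub> (\<pi> [^] k \<odot>\<^bsub>W\<^esub> u)"
    using u(1) by (simp add: m_comm W.smult_assoc1)
  then show thesis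
    using that[of "\<pi> [^] k \<odot>\<^bsub>W\<^esub> u"] u(1) k by simp
qed

text \<open>The ratio of the number of functionals on \<open>N\<close> vanishing on \<open>N\<^sub>0\<close> to the size of \<open>N\<close> does not
  depend on \<open>N\<close>, since each one-generator step preserves it.\<close>

lemma (in nilpotent_uniformiser) card_vanishing_functionals:
  assumes "module R W" and fin: "finite (carrier R)" "finite (carrier W)"
    and "submodule N R W" "N\<^sub>0 \<subseteq> N"
  shows "card {f \<in> functionals R W (carrier W). \<forall>y\<in>N\<^sub>0. f y = \<zero>} * card N
    = card {f \<in> functionals R W N. \<forall>y\<in>N\<^sub>0. f y = \<zero>} * card (carrier W)"
  using assms(4,5)
proof (induction "card (carrier W) - card N" arbitrary: N rule: less_induct)
  case less
  interpret W: module R W by fact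
  show ?case
  proof (cases "N = carrier W")
    case False
    then obtain w where w: "w \<in> carrier W" "w \<notin> N" "\<pi> \<odot>\<^bsub>W\<^esub> w \<in> N"
      using minimal_generator_exists[OF assms(1) less.prems(1)] by blast
    interpret E: one_generator_extension R \<pi> W N w
      by (intro one_generator_extension.intro one_generator_extension_axioms.intro)
        (fact nilpotent_uniformiser_axioms assms(1) less.prems(1) w)+
    let ?N' = "adjoin R W N w"
    have sub: "?N' \<subseteq> carrier W"
      using W.submoduleE(1)[OF E.submodule_adjoin] .
    then have finN': "finite ?N'"
      using fin(2) finite_subset by blast
    have "card N < card ?N'"
      using E.subset_adjoin E.generator_in_adjoin w(2) finN' by (intro psubset_card_mono) auto
    moreover have "card ?N' \<le> card (carrier W)"
      using sub fin(2) card_mono by blast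
    ultimately have IH: "card {f \<in> functionals R W (carrier W). \<forall>y\<in>N\<^sub>0. f y = \<zero>} * card ?N'
        = card {f \<in> functionals R W ?N'. \<forall>y\<in>N\<^sub>0. f y = \<zero>} * card (carrier W)"
      using less.hyps[of ?N'] E.submodule_adjoin less.prems(2) E.subset_adjoin by auto
    have "card ?N' > 0"
      using finN' E.generator_in_adjoin by (auto simp: card_gt_0_iff)
    moreover have "card {f \<in> functionals R W (carrier W). \<forall>y\<in>N\<^sub>0. f y = \<zero>} * card N * card ?N'
        = card {f \<in> functionals R W N. \<forall>y\<in>N\<^sub>0. f y = \<zero>} * card (carrier W) * card ?N'"
      (is "?a * _ * _ = ?c * _ * _")
    proof -
      have "?a * card N * card ?N' = ?a * card ?N' * card N"
        by simp
      also note IH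
      also have "card {f \<in> functionals R W ?N'. \<forall>y\<in>N\<^sub>0. f y = \<zero>} * card (carrier W) * card N
          = card {f \<in> functionals R W ?N'. \<forall>y\<in>N\<^sub>0. f y = \<zero>} * card N * card (carrier W)"
        by simp
      also note E.card_vanishing_functionals_adjoin[OF fin less.prems(2)]
      finally show ?thesis
        by (simp only: mult_ac)
    qed
    ultimately show ?thesis
      by simp
  qed simp
qed

text \<open>The case \<open>N\<^sub>0 = N\<close> of the preceding lemma, where only the zero functional on \<open>N\<close> is left.\<close>

lemma (in nilpotent_uniformiser) card_annihilator:
  assumes "module R W" and fin: "finite (carrier R)" "finite (carrier W)"
    and N: "submodule N R W"
  shows "card {\<psi> \<in> carrier (dual_module R W). \<forall>y\<in>N. \<psi> y = \<zero>} * card N = card (carrier W)"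
proof -
  interpret W: module R W by fact
  have "{f \<in> functionals R W N. \<forall>y\<in>N. f y = \<zero>} = {\<lambda>y\<in>N. \<zero>}"
  proof (intro subset_antisym subsetI)
    fix f assume f: "f \<in> {f \<in> functionals R W N. \<forall>y\<in>N. f y = \<zero>}"
    have "f = (\<lambda>y\<in>N. \<zero>)"
      by (rule extensionalityI[where A = N]) (use f functionalsD(4) in auto)
    then show "f \<in> {\<lambda>y\<in>N. \<zero>}" by simp
  next
    fix f assume "f \<in> {\<lambda>y\<in>N. \<zero>}"
    then show "f \<in> {f \<in> functionals R W N. \<forall>y\<in>N. f y = \<zero>}"
      using W.submoduleE(4,5)[OF N] by (auto intro!: functionalsI)
  qed
  then show ?thesis
    using card_vanishing_functionals[OF assms subset_refl] by (simp add: functionals_def)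
qed


section \<open>Average sizes of kernels\<close>

context module_representation
begin

text \<open>Double counting of the pairs \<open>(a, x)\<close> with \<open>\<theta> a x = \<zero>\<close>.\<close>

lemma ask_circ:
  assumes "finite (carrier M)" "finite (carrier V)"
  shows "ask V M W (rep_circ M V \<theta>)
    = real (card (carrier M)) / real (card (carrier V)) * ask M V W \<theta>"
proof -
  have pos: "card (carrier M) \<noteq> 0"
    using assms(1) M.zero_closed by auto
  have "(\<Sum>x\<in>carrier V. card (a_kernel M W (rep_circ M V \<theta> x)))
      = (\<Sum>x\<in>carrier V. card {a \<in> carrier M. \<theta> a x = \<zero>\<^bsub>W\<^esub>})"
    by (intro sum.cong refl arg_cong[where f = card]) (auto simp: a_kernel_def' rep_circ_def)
  also have "\<dots> = (\<Sum>a\<in>carrier M. card (a_kernel V W (\<theta> a)))"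
    unfolding a_kernel_def' by (rule sum_multicount_gen[symmetric]) (use assms in auto)
  finally have "(\<Sum>x\<in>carrier V. real (card (a_kernel M W (rep_circ M V \<theta> x))))
      = (\<Sum>a\<in>carrier M. real (card (a_kernel V W (\<theta> a))))"
    by (metis of_nat_sum)
  then show ?thesis
    using pos by (simp add: ask_def)
qed

text \<open>The equality holds for each \<open>a\<close> separately: the kernel of the transpose of \<open>\<theta> a\<close> is the
  annihilator of the image of \<open>\<theta> a\<close>.\<close>

lemma ask_vee:
  assumes "nilpotent_uniformiser R \<pi>"
    and fin: "finite (carrier R)" "finite (carrier V)" "finite (carrier W)"
  shows "ask M (dual_module R W) (dual_module R V) (rep_vee R M V W \<theta>)
    = real (card (carrier W)) / real (card (carrier V)) * ask M V W \<theta>"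
proof -
  interpret nilpotent_uniformiser R \<pi> by fact
  have posV: "card (carrier V) \<noteq> 0"
    using fin V.zero_closed by auto
  have "real (card (a_kernel (dual_module R W) (dual_module R V) (rep_vee R M V W \<theta> a)))
      = real (card (carrier W)) / real (card (carrier V)) * real (card (a_kernel V W (\<theta> a)))"
    if a: "a \<in> carrier M" for a
  proof -
    let ?A = "a_kernel (dual_module R W) (dual_module R V) (rep_vee R M V W \<theta> a)"
    have f: "\<theta> a \<in> carrier (Hom_module R V W)"
      by (rule Hom_moduleD(1)[OF hom a])
    have eq: "(\<lambda>x\<in>carrier V. \<psi> (\<theta> a x)) = (\<lambda>x\<in>carrier V. \<zero>\<^bsub>R\<^esub>)
        \<longleftrightarrow> (\<forall>x\<in>carrier V. \<psi> (\<theta> a x) = \<zero>\<^bsub>R\<^esub>)" for \<psi>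
      by (auto simp: fun_eq_iff restrict_def)
    have "?A = {\<psi> \<in> carrier (dual_module R W). \<forall>y\<in>\<theta> a ` carrier V. \<psi> y = \<zero>\<^bsub>R\<^esub>}"
      using a by (auto simp: a_kernel_def' rep_vee_def eq dual_module_def[of R V]
          Hom_module_ops regular_module_def[of R])
    then have 1: "card ?A * card (\<theta> a ` carrier V) = card (carrier W)"
      using card_annihilator[OF W.module_axioms fin(1,3)
          submodule_image[OF V.module_axioms W.module_axioms f]] by simp
    have 2: "card (carrier V) = card (a_kernel V W (\<theta> a)) * card (\<theta> a ` carrier V)"
      by (rule card_eq_card_kernel_mult_card_image[OF V.module_axioms W.module_axioms f fin(2)])
    have "card ?A * card (carrier V) = card (carrier W) * card (a_kernel V W (\<theta> a))"
      unfolding 2 1[symmetric] by simp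
    then show ?thesis
      using posV by (simp add: field_simps flip: of_nat_mult)
  qed
  then show ?thesis
    by (simp add: ask_def sum_distrib_left mult_ac)
qed

text \<open>Both sides are obtained from the trilinear map \<open>(a, x, \<psi>) \<mapsto> \<psi> (\<theta> a x)\<close> by taking its
  arguments in the order \<open>\<psi>\<close>, \<open>x\<close>, \<open>a\<close>. The right-hand side is accessible to (i), (ii) and (i)
  in succession.\<close>

lemma rep_bullet_eq_circ_vee_circ:
  "rep_bullet R M V W \<theta>
    = rep_circ V (dual_module R W) (rep_vee R V M W (rep_circ M V \<theta>))"
  unfolding rep_bullet_def rep_circ_def rep_vee_def by (auto intro!: restrict_ext)

lemma ask_bullet:
  assumes "nilpotent_uniformiser R \<pi>"
    and fin: "finite (carrier R)" "finite (carrier M)" "finite (carrier V)" "finite (carrier W)"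
  shows "ask (dual_module R W) V (dual_module R M) (rep_bullet R M V W \<theta>) = ask M V W \<theta>"
proof -
  interpret nilpotent_uniformiser R \<pi> by fact
  interpret C: module_representation R V M W "rep_circ M V \<theta>"
    by (rule module_representation_circ)
  interpret D: module_representation R V "dual_module R W" "dual_module R M"
    "rep_vee R V M W (rep_circ M V \<theta>)"
    by (rule C.module_representation_vee)
  \<comment> \<open>The annihilator of the zero submodule is the whole dual, so the dual has the size of \<open>W\<close>.\<close>
  have "{\<psi> \<in> carrier (dual_module R W). \<forall>y\<in>{\<zero>\<^bsub>W\<^esub>}. \<psi> y = \<zero>\<^bsub>R\<^esub>} = carrier (dual_module R W)"
    using Hom_module_zero[OF W.module_axioms module_regular_module[OF M.R.is_cring]]
    by (auto simp: dual_module_def regular_module_def)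
  moreover have "submodule {\<zero>\<^bsub>W\<^esub>} R W"
    by (rule W.submoduleI) auto
  ultimately have dual: "card (carrier (dual_module R W)) = card (carrier W)"
    using card_annihilator[OF W.module_axioms fin(1,4), of "{\<zero>\<^bsub>W\<^esub>}"] by simp
  have pos: "card (carrier M) \<noteq> 0" "card (carrier V) \<noteq> 0" "card (carrier W) \<noteq> 0"
    using fin M.zero_closed V.zero_closed W.zero_closed by auto
  then have "finite (carrier (dual_module R W))"
    using dual by (metis card.infinite)
  then show ?thesis
    unfolding rep_bullet_eq_circ_vee_circ
    using D.ask_circ C.ask_vee[OF assms(1) fin(1,2,4)] ask_circ fin pos
    by (simp add: dual)
qed

end

theorem theorem5p2:
  fixes R :: "('r, 'k) ring_scheme"
    and M :: "('r, 'm, 'i) module_scheme"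
    and V :: "('r, 'v, 'j) module_scheme"
    and W :: "('r, 'w, 'l) module_scheme"
    and \<theta> :: "'m \<Rightarrow> 'v \<Rightarrow> 'w"
  assumes "truncated_dvr TYPE('d) R" and "finite (carrier R)"
    and "module_representation R M V W \<theta>"
    and "finite (carrier M)" and "finite (carrier V)" and "finite (carrier W)"
  shows "ask V M W (rep_circ M V \<theta>) =
           real (card (carrier M)) / real (card (carrier V)) * ask M V W \<theta> \<and>
         ask M (dual_module R W) (dual_module R V) (rep_vee R M V W \<theta>) =
           real (card (carrier W)) / real (card (carrier V)) * ask M V W \<theta> \<and>
         ask (dual_module R W) V (dual_module R M) (rep_bullet R M V W \<theta>) = ask M V W \<theta>"
proof -
  interpret module_representation R M V W \<theta> by fact
  obtain \<pi> where "nilpotent_uniformiser R \<pi>"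
    using truncated_dvr_imp_nilpotent_uniformiser[OF assms(1)] by blast
  then show ?thesis
    using ask_circ ask_vee ask_bullet assms(2,4-6) by blast
qed

end
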